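(* Let $\mathbb{P}$ and $\mathbb{V}$ be algebraic theories, with $\mathbb{P}$ consistent, let $T_{\mathbb{P}}$ be a stable universal set of $\mathbb{P}$-terms and $T_{\mathbb{V}}$ a stable universal set of $\mathbb{V}$-terms. Suppose there are terms $2 \vdash_{\mathbb{P}} p$ and $2 \vdash_{\mathbb{V}} v$ such that: (P1) $2 \vdash p(1,2) =_{\mathbb{P}} p(2,1)$; (P2) $1 \vdash p(1,1) =_{\mathbb{P}} 1$; (P3) for all $p' \in T_{\mathbb{P}}$ and every context $\Gamma$: if $\Gamma \vdash p(1,2) =_{\mathbb{P}} p'$ then $2 \vdash p'$; (V1) $1 \vdash v(1,1) =_{\mathbb{V}} 1$; (V2) for all $v' \in T_{\mathbb{V}}$ and every variable $x$: if $\Gamma \vdash x =_{\mathbb{V}} v'$ then $\{x\} \vdash v'$; (V3) for all $v' \in T_{\mathbb{V}}$: if $\Gamma \vdash v(1,2) =_{\mathbb{V}} v'$ then neither $\{1\} \vdash v'$ nor $\{2\} \vdash v'$. Then there is no composite theory of $\mathbb{P}$ after $\mathbb{V}$.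
   Context: An algebraic theory consists of a signature and equations; $u =_{\mathbb T} w$ means provable in equational logic. Variables are natural numbers, and the number $n$ also denotes the set $\{1,\dots,n\}$. $Y \vdash t$ means all variables of $t$ lie in $Y$; $\Gamma$ denotes an arbitrary variable context. For $2\vdash p$, $p(a,b)$ denotes $p$ with $a$ substituted for $1$ and $b$ for $2$. A theory is consistent if it does not prove $x=y$ for distinct variables. A set of terms of a theory is universal if every term is provably equal to a member of it, and stable if it is closed under substituting variables for variables. For theories $\mathbb{S},\mathbb{T}$ (here $\mathbb{T}=\mathbb{P}$ and $\mathbb{S}=\mathbb{V}$): a theory $\mathbb{U}$ contains them if its signature contains both signatures and all their equations are provable in $\mathbb{U}$; a $\mathbb{U}$-term is separated if it has the form $t[s_x/x]$ (simultaneous substitution) with $t$ a $\mathbb{T}$-term with variables in $X$ and each $s_x$ an $\mathbb{S}$-term; separated terms $t[s_x/x]$, $t'[s'_{x'}/x']$ (variables of $t,t'$ in $X,X'$) are equal modulo $(\mathbb{T},\mathbb{S})$ if there are $f:X\to Y$, $f':X'\to Y$ and $\mathbb{S}$-terms $\bar s_y$ with $t[f(x)/x]=_{\mathbb T}t'[f'(x')/x']$, $s_x=_{\mathbb S}\bar s_{f(x)}$, $s'_{x'}=_{\mathbb S}\bar s_{f'(x')}$. $\mathbb{U}$ is a composite theory of $\mathbb{T}$ after $\mathbb{S}$ if every $\mathbb{U}$-term is $\mathbb U$-equal to a separated term and any two separated terms $\mathbb{U}$-equal to a common term are equal modulo $(\mathbb{T},\mathbb{S})$. *)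

theory Defs
  imports "HOL-Library.FuncSet"
begin

datatype 'f trm = Var nat | Fn 'f "'f trm list"

fun vars :: "'f trm \<Rightarrow> nat set" where
  "vars (Var x) = {x}"
| "vars (Fn f ts) = (\<Union>t\<in>set ts. vars t)"

primrec subst :: "(nat \<Rightarrow> 'f trm) \<Rightarrow> 'f trm \<Rightarrow> 'f trm" where
  "subst \<sigma> (Var x) = \<sigma> x"
| "subst \<sigma> (Fn f ts) = Fn f (map (subst \<sigma>) ts)"

definition rename :: "(nat \<Rightarrow> nat) \<Rightarrow> 'f trm \<Rightarrow> 'f trm" where
  "rename f t = subst (\<lambda>x. Var (f x)) t"

text \<open>Substitution of \<open>a\<close> for the variable 1 and of \<open>b\<close> for the variable 2.\<close>

definition app2 :: "'f trm \<Rightarrow> 'f trm \<Rightarrow> 'f trm \<Rightarrow> 'f trm" where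
  "app2 t a b = subst (Var(1 := a, 2 := b)) t"

text \<open>A signature is a set of operation symbols paired with their finite arities; the
  same name with two arities counts as two symbols. All theories under consideration draw
  their symbols from one type \<open>'f\<close>, so that inclusion of signatures is set inclusion.\<close>

record 'f alg_theory =
  sig :: "('f \<times> nat) set"
  eqs :: "('f trm \<times> 'f trm) set"

inductive is_term :: "'f alg_theory \<Rightarrow> 'f trm \<Rightarrow> bool" for T where
  var: "is_term T (Var x)"
| fn: "(f, length ts) \<in> sig T \<Longrightarrow> (\<And>t. t \<in> set ts \<Longrightarrow> is_term T t) \<Longrightarrow> is_term T (Fn f ts)"

definition algebraic_theory :: "'f alg_theory \<Rightarrow> bool" where
  "algebraic_theory T \<longleftrightarrow> (\<forall>(l, r) \<in> eqs T. is_term T l \<and> is_term T r)"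

inductive proves :: "'f alg_theory \<Rightarrow> 'f trm \<Rightarrow> 'f trm \<Rightarrow> bool" for T where
  ax: "(l, r) \<in> eqs T \<Longrightarrow> proves T l r"
| refl: "is_term T t \<Longrightarrow> proves T t t"
| sym: "proves T t u \<Longrightarrow> proves T u t"
| trans: "proves T t u \<Longrightarrow> proves T u w \<Longrightarrow> proves T t w"
| cong: "(f, length ts) \<in> sig T \<Longrightarrow> list_all2 (proves T) ts us \<Longrightarrow> proves T (Fn f ts) (Fn f us)"
| subst: "proves T t u \<Longrightarrow> (\<And>x. is_term T (\<sigma> x)) \<Longrightarrow> proves T (subst \<sigma> t) (subst \<sigma> u)"

text \<open>The context only bounds the variables of the two sides, not those of intermediate
  terms of a derivation. For single-sorted theories this is no loss: superfluous variables in
  a derivation can be replaced by any term over the context (e.g. by either side).\<close>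

definition term_in :: "'f alg_theory \<Rightarrow> nat set \<Rightarrow> 'f trm \<Rightarrow> bool" where
  "term_in T Y t \<longleftrightarrow> is_term T t \<and> vars t \<subseteq> Y"

definition proves_in :: "'f alg_theory \<Rightarrow> nat set \<Rightarrow> 'f trm \<Rightarrow> 'f trm \<Rightarrow> bool" where
  "proves_in T Y t u \<longleftrightarrow> term_in T Y t \<and> term_in T Y u \<and> proves T t u"

definition consistent :: "'f alg_theory \<Rightarrow> bool" where
  "consistent T \<longleftrightarrow> (\<forall>x y. x \<noteq> y \<longrightarrow> \<not> proves T (Var x) (Var y))"

definition universal :: "'f alg_theory \<Rightarrow> 'f trm set \<Rightarrow> bool" where
  "universal T A \<longleftrightarrow> (\<forall>t\<in>A. is_term T t) \<and> (\<forall>t. is_term T t \<longrightarrow> (\<exists>t'\<in>A. proves T t t'))"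

definition stable :: "'f trm set \<Rightarrow> bool" where
  "stable A \<longleftrightarrow> (\<forall>t\<in>A. \<forall>f. rename f t \<in> A)"

definition contains :: "'f alg_theory \<Rightarrow> 'f alg_theory \<Rightarrow> bool" where
  "contains U T \<longleftrightarrow> sig T \<subseteq> sig U \<and> (\<forall>(l, r) \<in> eqs T. proves U l r)"

text \<open>A presentation of the separated term \<open>subst s t\<close>; the values of \<open>s\<close> outside
  \<open>X\<close> are irrelevant. Equality modulo \<open>(T, S)\<close> refers to such presentations.\<close>

definition separation ::
  "'f alg_theory \<Rightarrow> 'f alg_theory \<Rightarrow> nat set \<Rightarrow> 'f trm \<Rightarrow> (nat \<Rightarrow> 'f trm) \<Rightarrow> bool" where
  "separation T S X t s \<longleftrightarrow> term_in T X t \<and> (\<forall>x\<in>X. is_term S (s x))"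

definition separated :: "'f alg_theory \<Rightarrow> 'f alg_theory \<Rightarrow> 'f trm \<Rightarrow> bool" where
  "separated T S u \<longleftrightarrow> (\<exists>X t s. separation T S X t s \<and> u = subst s t)"

definition equal_modulo ::
  "'f alg_theory \<Rightarrow> 'f alg_theory \<Rightarrow>
   nat set \<Rightarrow> 'f trm \<Rightarrow> (nat \<Rightarrow> 'f trm) \<Rightarrow> nat set \<Rightarrow> 'f trm \<Rightarrow> (nat \<Rightarrow> 'f trm) \<Rightarrow> bool" where
  "equal_modulo T S X t s X' t' s' \<longleftrightarrow>
     (\<exists>Y f f' sbar. f \<in> X \<rightarrow> Y \<and> f' \<in> X' \<rightarrow> Y \<and> (\<forall>y\<in>Y. is_term S (sbar y)) \<and>
        proves T (rename f t) (rename f' t') \<and>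
        (\<forall>x\<in>X. proves S (s x) (sbar (f x))) \<and>
        (\<forall>x'\<in>X'. proves S (s' x') (sbar (f' x'))))"

definition composite_theory ::
  "'f alg_theory \<Rightarrow> 'f alg_theory \<Rightarrow> 'f alg_theory \<Rightarrow> bool" where
  \<comment> \<open>\<open>composite_theory U T S\<close>: \<open>U\<close> is a composite theory of \<open>T\<close> after \<open>S\<close>\<close>
  "composite_theory U T S \<longleftrightarrow>
     algebraic_theory U \<and> contains U T \<and> contains U S \<and>
     (\<forall>u. is_term U u \<longrightarrow> (\<exists>w. separated T S w \<and> proves U u w)) \<and>
     (\<forall>u X t s X' t' s'. separation T S X t s \<longrightarrow> separation T S X' t' s' \<longrightarrow>
        proves U u (subst s t) \<longrightarrow> proves U u (subst s' t') \<longrightarrow>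
        equal_modulo T S X t s X' t' s')"

end

theory Submission
  imports Defs
begin

text \<open>Write \<open>v(p(1,2), p(3,4))\<close> as a separated term \<open>t[s\<^sub>x/x]\<close> with \<open>t\<close> and all \<open>s\<^sub>x\<close> in the
  universal sets. Both renamings \<open>(3,4) \<mapsto> (1,2)\<close> and \<open>(3,4) \<mapsto> (2,1)\<close> turn this term into
  \<open>p(1,2)\<close>, so that, for \<open>x\<close> in \<open>t\<close>, each renamed \<open>s\<^sub>x\<close> has its variables in \<open>{1}\<close> or in \<open>{2}\<close>;
  the two conditions together leave at most one variable in \<open>s\<^sub>x\<close>. The renaming
  \<open>(1,2,3,4) \<mapsto> (1,1,2,2)\<close> instead yields \<open>v(1,2)\<close>, to which no term with at most one
  variable can be equal. Hence \<open>t\<close> would be equal in \<open>P\<close> to a variable not occurring in it,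
  against consistency.\<close>

text \<open>Here \<open>1\<close> mostly names a variable; rewriting it to \<open>Suc 0\<close>
  would spoil matching with the facts about \<open>Var 1\<close>.\<close>

declare One_nat_def [simp del]

section \<open>Substitution and renaming\<close>

lemma subst_subst: "subst \<sigma> (subst \<tau> t) = subst (\<lambda>x. subst \<sigma> (\<tau> x)) t"
  by (induction t) auto

lemma subst_cong_vars: "(\<And>x. x \<in> vars t \<Longrightarrow> \<sigma> x = \<tau> x) \<Longrightarrow> subst \<sigma> t = subst \<tau> t"
  by (induction t) auto

lemma subst_Var [simp]: "subst Var t = t"
  by (induction t) (auto intro: map_idI)

lemma vars_subst: "vars (subst \<sigma> t) = (\<Union>x\<in>vars t. vars (\<sigma> x))"
  by (induction t) auto

lemma vars_rename [simp]: "vars (rename f t) = f ` vars t"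
  by (auto simp: rename_def vars_subst)

lemma rename_rename: "rename g (rename f t) = rename (\<lambda>x. g (f x)) t"
  by (simp add: rename_def subst_subst)

lemma rename_subst: "rename f (subst s t) = subst (\<lambda>x. rename f (s x)) t"
  by (simp add: rename_def subst_subst)

text \<open>The left side would also rename any further variable of \<open>t\<close>, while the
  right side leaves it alone; hence the bound on \<open>vars t\<close>.\<close>

lemma rename_app2:
  assumes "vars t \<subseteq> {1..2}"
  shows "rename f (app2 t a b) = app2 t (rename f a) (rename f b)"
  unfolding app2_def rename_subst
proof (rule subst_cong_vars)
  fix x assume "x \<in> vars t"
  with assms have "x = 1 \<or> x = 2" by force
  then show "rename f ((Var(1 := a, 2 := b)) x) = (Var(1 := rename f a, 2 := rename f b)) x"
    by auto
qed

lemma app2_Var_Var [simp]: "app2 t (Var 1) (Var 2) = t"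
proof -
  have "Var(1 := Var 1, 2 := Var 2) = (Var :: nat \<Rightarrow> 'a trm)" by auto
  then show ?thesis by (simp add: app2_def)
qed

lemma rename_eq_app2:
  assumes "vars t \<subseteq> {1..2}"
  shows "rename f t = app2 t (Var (f 1)) (Var (f 2))"
  using rename_app2[OF assms, of f "Var 1" "Var 2"] by (simp add: rename_def)

section \<open>Provable equality under substitution and extension of the theory\<close>

lemma is_term_subst: "is_term T t \<Longrightarrow> (\<And>x. is_term T (\<sigma> x)) \<Longrightarrow> is_term T (subst \<sigma> t)"
  by (induction t rule: is_term.induct) (auto intro!: is_term.fn)

lemma is_term_rename: "is_term T t \<Longrightarrow> is_term T (rename f t)"
  unfolding rename_def by (rule is_term_subst) (auto intro: is_term.var)

lemma is_term_app2: "is_term T t \<Longrightarrow> is_term T a \<Longrightarrow> is_term T b \<Longrightarrow> is_term T (app2 t a b)"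
  unfolding app2_def by (rule is_term_subst) (auto intro: is_term.var)

lemma proves_rename: "proves T t u \<Longrightarrow> proves T (rename f t) (rename f u)"
  unfolding rename_def by (rule proves.subst) (auto intro: is_term.var)

lemma proves_subst_cong:
  assumes "is_term T t" and "\<And>x. proves T (\<sigma> x) (\<tau> x)"
  shows "proves T (subst \<sigma> t) (subst \<tau> t)"
  using assms(1)
proof (induction t rule: is_term.induct)
  case (var x)
  then show ?case by (simp add: assms(2))
next
  case (fn f ts)
  then show ?case
    by (auto intro!: proves.cong simp: list_all2_conv_all_nth)
qed

lemma proves_app2_cong:
  assumes "is_term T t" "proves T a a'" "proves T b b'"
  shows "proves T (app2 t a b) (app2 t a' b')"
  unfolding app2_def using assms
  by (intro proves_subst_cong) (auto intro: proves.refl is_term.var)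

text \<open>Substitute \<open>a\<close> for all variables at once. Stated for any theory, this lets
  an idempotence law of \<open>P\<close> or \<open>V\<close> be applied in \<open>U\<close> to mixed
  terms.\<close>

lemma proves_app2_idem:
  assumes "proves T (app2 t (Var 1) (Var 1)) (Var 1)" "vars t \<subseteq> {1..2}" "is_term T a"
  shows "proves T (app2 t a a) a"
proof -
  have "subst (\<lambda>_. a) (app2 t (Var 1) (Var 1)) = app2 t a a"
    unfolding app2_def subst_subst
  proof (rule subst_cong_vars)
    fix x assume "x \<in> vars t"
    with assms(2) have "x = 1 \<or> x = 2" by force
    then show "subst (\<lambda>_. a) ((Var(1 := Var 1, 2 := Var 1)) x) = (Var(1 := a, 2 := a)) x"
      by auto
  qed
  with proves.subst[OF assms(1), of "\<lambda>_. a"] assms(3) show ?thesis by simp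
qed

lemma is_term_mono: "is_term T t \<Longrightarrow> contains U T \<Longrightarrow> is_term U t"
  by (induction t rule: is_term.induct) (auto intro: is_term.intros simp: contains_def)

lemma proves_mono:
  assumes "contains U T" "proves T t u"
  shows "proves U t u"
  using assms(2)
proof (induction rule: proves.induct)
  case (ax l r)
  with assms(1) show ?case by (auto simp: contains_def)
next
  case (cong f ts us)
  with assms(1) show ?case
    by (auto intro!: proves.cong elim: list_all2_mono simp: contains_def)
qed (use assms(1) in \<open>auto intro: proves.intros is_term_mono\<close>)

lemma proves_of_Var_Var:
  assumes "proves T (Var x) (Var y)" "x \<noteq> y" "is_term T t" "is_term T u"
  shows "proves T t u"
  using proves.subst[OF assms(1), of "\<lambda>z. if z = x then t else u"] assms(2-4) by simp

text \<open>Renaming \<open>y\<close> to \<open>z\<close> fixes \<open>t\<close> but turns the right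
  side into \<open>z\<close>, so \<open>t\<close> equals both variables.\<close>

lemma proves_Var_absent:
  assumes "proves T t (Var y)" "y \<notin> vars t"
  shows "proves T (Var z) (Var y)"
proof -
  have "subst (\<lambda>x. Var ((id(y := z)) x)) t = subst Var t"
    using assms(2) by (intro subst_cong_vars) auto
  then have "rename (id(y := z)) t = t" by (simp add: rename_def)
  with proves_rename[OF assms(1), of "id(y := z)"] have "proves T t (Var z)"
    by (simp add: rename_def)
  with assms(1) show ?thesis by (blast intro: proves.sym proves.trans)
qed

section \<open>Separated terms and equality modulo two theories\<close>

lemma separated_universal:
  assumes "separated P V w" "universal P TP" "universal V TV" "contains U P" "contains U V"
  obtains t s where "t \<in> TP" "\<And>x. s x \<in> TV" "proves U w (subst s t)"
proof -
  obtain X t0 s0 where sep: "separation P V X t0 s0" and w: "w = subst s0 t0"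
    using assms(1) by (auto simp: separated_def)
  \<comment> \<open>The default \<open>Var x\<close> makes every value a \<open>V\<close>-term, as
    the rule \<open>proves.subst\<close> and the choice of representatives for all \<open>x\<close>
    require.\<close>
  define s1 where "s1 = (\<lambda>x. if x \<in> X then s0 x else Var x)"
  have t0: "is_term P t0" and "vars t0 \<subseteq> X" using sep by (auto simp: separation_def term_in_def)
  have s1: "is_term V (s1 x)" for x
    using sep by (auto simp: s1_def separation_def intro: is_term.var)
  obtain t where t: "t \<in> TP" "proves P t0 t" using assms(2) t0 by (auto simp: universal_def)
  have "\<exists>s. \<forall>x. s x \<in> TV \<and> proves V (s1 x) (s x)"
    using assms(3) s1 unfolding universal_def by (intro choice) blast
  then obtain s where s: "\<And>x. s x \<in> TV" "\<And>x. proves V (s1 x) (s x)" by blast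
  have "w = subst s1 t0"
    unfolding w using \<open>vars t0 \<subseteq> X\<close> by (intro subst_cong_vars) (auto simp: s1_def)
  moreover have "proves U (subst s1 t0) (subst s1 t)"
    using t(2) s1 assms(4,5) by (blast intro: proves.subst proves_mono is_term_mono)
  moreover have "proves U (subst s1 t) (subst s t)"
  proof (rule proves_subst_cong)
    show "is_term U t" using t(1) assms(2,4) by (auto simp: universal_def intro: is_term_mono)
    show "proves U (s1 x) (s x)" for x by (rule proves_mono[OF assms(5) s(2)])
  qed
  ultimately have "proves U w (subst s t)" by (auto intro: proves.trans)
  with t(1) s(1) show thesis by (rule that)
qed

text \<open>Consistency of \<open>V\<close> makes \<open>f'\<close> injective on the variables 1 and
  2, so some \<open>g\<close> undoes it and \<open>p\<close> equals a renaming of \<open>t\<close>.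
  By \<open>P3\<close> the variables of that renaming are among 1 and 2, so \<open>f x\<close> is
  \<open>f' 1\<close> or \<open>f' 2\<close>; then \<open>s x\<close> is equal in \<open>V\<close>
  to a variable, and \<open>V2\<close> applies.\<close>

lemma equal_modulo_binary_vars:
  assumes eq: "equal_modulo P V UNIV t s UNIV p Var"
    and "t \<in> TP" "\<And>x. s x \<in> TV" "universal P TP" "stable TP" "universal V TV"
    and "term_in P {1..2} p"
    and V_cons: "consistent V"
    and P3: "\<And>p' \<Gamma>. p' \<in> TP \<Longrightarrow> proves_in P \<Gamma> (app2 p (Var 1) (Var 2)) p' \<Longrightarrow> term_in P {1..2} p'"
    and V2: "\<And>v' \<Gamma> x. v' \<in> TV \<Longrightarrow> proves_in V \<Gamma> (Var x) v' \<Longrightarrow> term_in V {x} v'"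
    and x: "x \<in> vars t"
  shows "vars (s x) \<subseteq> {1} \<or> vars (s x) \<subseteq> {2}"
proof -
  obtain f f' r where tp: "proves P (rename f t) (rename f' p)"
    and sr: "\<And>x. proves V (s x) (r (f x))" and Vr: "\<And>x. proves V (Var x) (r (f' x))"
    using eq by (auto simp: equal_modulo_def)
  have "f' 1 \<noteq> f' 2"
  proof
    assume "f' 1 = f' 2"
    then have "proves V (Var 1) (Var 2)" using Vr[of 1] Vr[of 2]
      by (auto intro: proves.trans proves.sym)
    with V_cons show False by (auto simp: consistent_def)
  qed
  \<comment> \<open>The value 3 marks everything other than \<open>f' 1\<close> and
    \<open>f' 2\<close>; \<open>P3\<close> will exclude it.\<close>
  define g where "g y = (if y = f' 1 then 1 else if y = f' 2 then 2 else 3 :: nat)" for y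
  have g12: "g (f' 1) = 1" "g (f' 2) = 2" using \<open>f' 1 \<noteq> f' 2\<close> by (auto simp: g_def)
  have "rename g (rename f' p) = p"
    unfolding rename_rename using assms(7) g12 by (subst rename_eq_app2) (auto simp: term_in_def)
  with proves_rename[OF tp, of g] have gt: "proves P p (rename g (rename f t))"
    by (auto intro: proves.sym)
  have TPgt: "rename g (rename f t) \<in> TP" using assms(2,5) by (auto simp: stable_def)
  have "is_term P (rename g (rename f t))" "is_term P p"
    using TPgt assms(4,7) by (auto simp: universal_def term_in_def)
  with gt have "proves_in P UNIV (app2 p (Var 1) (Var 2)) (rename g (rename f t))"
    by (simp add: proves_in_def term_in_def)
  from P3[OF TPgt this] x have "g (f x) \<in> {1..2}" by (simp add: term_in_def image_subset_iff)
  then obtain i :: nat where i: "i = 1 \<or> i = 2" "f x = f' i"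
    by (auto simp: g_def split: if_splits)
  have "proves V (Var i) (s x)"
    using sr[of x] Vr[of i] i(2) by (auto intro: proves.trans proves.sym)
  then have "proves_in V UNIV (Var i) (s x)"
    using assms(3)[of x] assms(6) by (auto simp: proves_in_def term_in_def universal_def intro: is_term.var)
  from V2[OF assms(3) this] i(1) show ?thesis by (auto simp: term_in_def)
qed

theorem theorem3p6:
  fixes P V :: "'f alg_theory" and TP TV :: "'f trm set" and p v :: "'f trm"
  assumes "algebraic_theory P" and "algebraic_theory V"
    and "consistent P"
    and "universal P TP" and "stable TP"
    and "universal V TV" and "stable TV"
    and "term_in P {1..2} p" and "term_in V {1..2} v"
    and P1: "proves_in P {1..2} (app2 p (Var 1) (Var 2)) (app2 p (Var 2) (Var 1))"
    and P2: "proves_in P {1..1} (app2 p (Var 1) (Var 1)) (Var 1)"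
    and P3: "\<And>p' \<Gamma>. p' \<in> TP \<Longrightarrow> proves_in P \<Gamma> (app2 p (Var 1) (Var 2)) p' \<Longrightarrow> term_in P {1..2} p'"
    and V1: "proves_in V {1..1} (app2 v (Var 1) (Var 1)) (Var 1)"
    and V2: "\<And>v' \<Gamma> x. v' \<in> TV \<Longrightarrow> proves_in V \<Gamma> (Var x) v' \<Longrightarrow> term_in V {x} v'"
    and V3: "\<And>v' \<Gamma>. v' \<in> TV \<Longrightarrow> proves_in V \<Gamma> (app2 v (Var 1) (Var 2)) v' \<Longrightarrow>
               \<not> term_in V {1} v' \<and> \<not> term_in V {2} v'"
  shows "\<not> (\<exists>U :: 'f alg_theory. composite_theory U P V)"
proof
  assume "\<exists>U :: 'f alg_theory. composite_theory U P V"
  then obtain U :: "'f alg_theory" where comp: "composite_theory U P V" by blast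
  have UP: "contains U P" and UV: "contains U V"
    and sep_ex: "\<And>u. is_term U u \<Longrightarrow> \<exists>w. separated P V w \<and> proves U u w"
    and sep_uniq: "\<And>u X t s X' t' s'. separation P V X t s \<Longrightarrow> separation P V X' t' s' \<Longrightarrow>
        proves U u (subst s t) \<Longrightarrow> proves U u (subst s' t') \<Longrightarrow> equal_modulo P V X t s X' t' s'"
    using comp unfolding composite_theory_def by blast+
  have p: "is_term P p" "vars p \<subseteq> {1..2}" and v: "is_term V v" "vars v \<subseteq> {1..2}"
    using assms(8,9) by (auto simp: term_in_def)
  have TP: "t \<in> TP \<Longrightarrow> is_term P t" and TV: "t \<in> TV \<Longrightarrow> is_term V t" for t
    using assms(4,6) by (auto simp: universal_def)
  have Up: "is_term U p" and Uv: "is_term U v" using p v UP UV by (auto intro: is_term_mono)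
  note terms = is_term_app2 Up Uv is_term.var

  have V3': "\<not> vars v' \<subseteq> {1} \<and> \<not> vars v' \<subseteq> {2}" if "v' \<in> TV" "proves V v v'" for v'
  proof -
    have "proves_in V UNIV (app2 v (Var 1) (Var 2)) v'"
      using that v TV by (simp add: proves_in_def term_in_def)
    from V3[OF that(1) this] that(1) TV show ?thesis by (simp add: term_in_def)
  qed

  \<comment> \<open>An inconsistent \<open>V\<close> equates the variable 1 with a representative
    \<open>v'\<close> of \<open>v\<close>; \<open>V2\<close> then confines \<open>v'\<close> to the
    variable 1, against \<open>V3\<close>.\<close>
  have V_cons: "consistent V"
    unfolding consistent_def
  proof (intro allI impI notI)
    fix x y :: nat assume xy: "x \<noteq> y" and eq: "proves V (Var x) (Var y)"
    obtain v' where v': "v' \<in> TV" "proves V v v'"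
      using assms(6) v by (auto simp: universal_def)
    have "proves V (Var 1) v'"
      using eq xy v'(1) TV by (intro proves_of_Var_Var[OF eq xy]) (auto intro: is_term.var)
    then have "proves_in V UNIV (Var 1) v'"
      using v'(1) TV by (auto simp: proves_in_def term_in_def intro: is_term.var)
    from V2[OF v'(1) this] V3'[OF v'] show False by (simp add: term_in_def)
  qed

  define u where "u = app2 v (app2 p (Var 1) (Var 2)) (app2 p (Var 3) (Var 4))"
  have "is_term U u" unfolding u_def by (intro terms)
  then obtain w where w: "separated P V w" "proves U u w" using sep_ex by blast
  obtain t s where t: "t \<in> TP" and s: "\<And>x. s x \<in> TV" and "proves U w (subst s t)"
    using separated_universal[OF w(1) assms(4,6) UP UV] by blast
  with w(2) have ust: "proves U u (subst s t)" by (blast intro: proves.trans)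
  have s_ren: "rename f (s x) \<in> TV" for f x
    using s assms(7) by (auto simp: stable_def)
  have sep_ren: "separation P V UNIV t (\<lambda>x. rename f (s x))" for f
    using t TP s_ren TV by (auto simp: separation_def term_in_def)
  have u_ren: "rename f u = app2 v (app2 p (Var (f 1)) (Var (f 2))) (app2 p (Var (f 3)) (Var (f 4)))"
    for f
    unfolding u_def by (simp only: rename_app2[OF v(2)] rename_app2[OF p(2)]) (simp add: rename_def)
  \<comment> \<open>Renaming \<open>u\<close> changes only the inner terms, so one and the same
    \<open>t\<close> serves for all renamings of \<open>u\<close>.\<close>
  have modulo: "equal_modulo P V UNIV t (\<lambda>x. rename f (s x)) UNIV t' s'"
    if "proves U (rename f u) (subst s' t')" "separation P V UNIV t' s'" for f t' s'
    using sep_ren that(2) proves_rename[OF ust, of f, unfolded rename_subst] that(1) by (rule sep_uniq)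

  have vpp: "proves U (app2 v p p) p"
    by (rule proves_app2_idem) (use V1 v Up UV in \<open>auto simp: proves_in_def intro: proves_mono\<close>)
  have pp: "proves U (app2 p (Var i) (Var i)) (Var i)" for i
    by (rule proves_app2_idem) (use P2 p UP in \<open>auto simp: proves_in_def intro: proves_mono is_term.var\<close>)
  have p21: "proves U (app2 p (Var 2) (Var 1)) p"
    using P1 UP by (auto simp: proves_in_def intro: proves_mono proves.sym)
  have vars_s: "vars (rename f (s x)) \<subseteq> {1} \<or> vars (rename f (s x)) \<subseteq> {2}"
    if "proves U (rename f u) p" "x \<in> vars t" for f x
  proof -
    have "equal_modulo P V UNIV t (\<lambda>x. rename f (s x)) UNIV p Var"
      using that(1) p by (intro modulo) (auto simp: separation_def term_in_def intro: is_term.var)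
    from equal_modulo_binary_vars[OF this t s_ren assms(4,5,6,8) V_cons P3 V2 that(2)]
    show ?thesis .
  qed

  define f1 :: "nat \<Rightarrow> nat" where "f1 = id(3 := 1, 4 := 2)"
  define f2 :: "nat \<Rightarrow> nat" where "f2 = id(3 := 2, 4 := 1)"
  define f3 :: "nat \<Rightarrow> nat" where "f3 = id(2 := 1, 3 := 2, 4 := 2)"
  have 1: "proves U (rename f1 u) p"
    unfolding u_ren by (simp add: f1_def vpp)
  \<comment> \<open>Commutativity of \<open>p\<close> enters here: the second argument of
    \<open>v\<close> becomes \<open>p(2,1)\<close>.\<close>
  have "proves U (rename f2 u) (app2 v p p)"
    unfolding u_ren
    by (simp add: f2_def) (intro proves_app2_cong Uv proves.refl Up p21)
  with vpp have 2: "proves U (rename f2 u) p" by (blast intro: proves.trans)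
  have 3: "proves U (rename f3 u) v"
    using proves_app2_cong[OF Uv pp[of 1] pp[of 2]] unfolding u_ren by (simp add: f3_def)

  have single: "vars (rename f3 (s x)) \<subseteq> {1} \<or> vars (rename f3 (s x)) \<subseteq> {2}"
    if x: "x \<in> vars t" for x
  proof -
    obtain i j :: nat where i: "f1 ` vars (s x) \<subseteq> {i}" "i = 1 \<or> i = 2"
      and j: "f2 ` vars (s x) \<subseteq> {j}" "j = 1 \<or> j = 2"
      using vars_s[OF 1 x] vars_s[OF 2 x] by auto
    \<comment> \<open>For \<open>y\<close> = 1, 2, 3, 4 the pairs \<open>(f1 y, f2 y)\<close> are
      (1,1), (2,2), (1,2), (2,1); any other \<open>y\<close> is fixed by both maps and falls
      outside. So \<open>(i, j)\<close> determines \<open>y\<close>, and \<open>i = j\<close> holds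
      exactly for \<open>y\<close> = 1, 2, which \<open>f3\<close> sends to 1.\<close>
    have "f3 y = (if i = j then 1 else 2)" if "y \<in> vars (s x)" for y
    proof -
      have "f1 y = i" "f2 y = j" using that i(1) j(1) by auto
      then show ?thesis using i(2) j(2) by (auto simp: f1_def f2_def f3_def split: if_splits)
    qed
    then have "f3 ` vars (s x) \<subseteq> {if i = j then 1 else 2}" by auto
    then show ?thesis by (auto split: if_splits)
  qed

  \<comment> \<open>The term \<open>v\<close> is presented with a bare variable as outer term; the
    choice of 0 is arbitrary.\<close>
  have "equal_modulo P V UNIV t (\<lambda>x. rename f3 (s x)) UNIV (Var 0) (\<lambda>_. v)"
    using 3 v by (intro modulo) (auto simp: separation_def term_in_def intro: is_term.var)
  then obtain f f' r where tf: "proves P (rename f t) (rename f' (Var 0))"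
    and sr: "\<And>x. proves V (rename f3 (s x)) (r (f x))" and vr: "\<And>x. proves V v (r (f' x))"
    by (auto simp: equal_modulo_def)
  have "f' 0 \<notin> vars (rename f t)"
  proof
    assume "f' 0 \<in> vars (rename f t)"
    then obtain x where x: "x \<in> vars t" "f' 0 = f x" by auto
    \<comment> \<open>Both sides equal the common inner term \<open>r (f x)\<close>, which is also
      \<open>r (f' 0)\<close>.\<close>
    have "proves V v (rename f3 (s x))"
      using sr[of x] vr[of 0] x(2) by (auto intro: proves.sym proves.trans)
    with V3'[OF s_ren this] single[OF x(1)] show False by blast
  qed
  \<comment> \<open>\<open>Suc (f' 0)\<close> is just some variable distinct from
    \<open>f' 0\<close>.\<close>
  from proves_Var_absent[OF tf[unfolded rename_def[of _ "Var 0"] subst.simps] this, of "Suc (f' 0)"] \<open>consistent P\<close> show False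
    by (simp add: consistent_def)
qed

end
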